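(* Let $G$ be a simple, connected, finite and planar graph with $n$ vertices and $r = \mathrm{girth}(G) = \mathrm{circum}(G)$. If $r$ is even and $n \geq 4$, then \[|E(G)| \leq n-1+\left\lfloor\frac{n-\frac{r}{2}-1}{\frac{r}{2}-1}\right\rfloor,\] and if $r$ is odd and $n \geq 3$, then \[|E(G)| \leq n-1+\left\lfloor\frac{n-1}{r-1}\right\rfloor.\]
   Context: For a graph $G$ containing at least one cycle, $\mathrm{girth}(G)$ and $\mathrm{circum}(G)$ are the lengths of a shortest and of a longest cycle in $G$; they are defined only for graphs containing a cycle, so the hypothesis entails that $G$ contains a cycle. $E(G)$ is the edge set of $G$. *)

theory Defs
  imports "HOL-Analysis.Analysis" "Graph_Theory.Graph_Theory"
begin

text \<open>Finite simple graphs are the symmetric, loop-free digraphs without parallel arcs of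
  the locale \<^locale>\<open>Digraph.graph\<close>: an undirected edge \<open>{u, v}\<close> is a pair of opposite arcs.
  The edge set below counts such a pair once.\<close>

definition uedges :: "('a, 'b) pre_digraph \<Rightarrow> 'a set set" where
  "uedges G = (\<lambda>e. {tail G e, head G e}) ` arcs G"

text \<open>In a symmetric digraph \<^const>\<open>pre_digraph.cycle\<close> also admits the closed walks \<open>u, v, u\<close>
  along a single edge; the length condition excludes exactly these.\<close>

definition ucycle :: "('a, 'b) pre_digraph \<Rightarrow> 'b awalk \<Rightarrow> bool" where
  "ucycle G p \<longleftrightarrow> pre_digraph.cycle G p \<and> 3 \<le> length p"

definition cycle_lengths :: "('a, 'b) pre_digraph \<Rightarrow> nat set" where
  "cycle_lengths G = length ` {p. ucycle G p}"

text \<open>Both are meaningful only for a finite graph that contains a cycle.\<close>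

definition girth :: "('a, 'b) pre_digraph \<Rightarrow> nat" where
  "girth G = Min (cycle_lengths G)"

definition circum :: "('a, 'b) pre_digraph \<Rightarrow> nat" where
  "circum G = Max (cycle_lengths G)"

lemma finite_cycle_lengths:
  assumes "fin_digraph G"
  shows "finite (cycle_lengths G)"
proof -
  interpret fin_digraph G by fact
  have "length p \<le> card (arcs G)" if p: "cycle p" for p
  proof -
    obtain u where "awalk u p u" "distinct p"
      using p unfolding cycle_conv by blast
    then have "length p = card (set p)" "set p \<subseteq> arcs G"
      by (auto simp: distinct_card awalk_def)
    then show ?thesis
      by (simp add: card_mono)
  qed
  then have "cycle_lengths G \<subseteq> {..card (arcs G)}"
    by (auto simp: cycle_lengths_def ucycle_def)
  then show ?thesis
    by (rule finite_subset) simp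
qed

text \<open>A plane drawing sends vertices to distinct points and edges to simple arcs between the
  points of their end vertices; an arc meets no other vertex, and two arcs meet only in the
  points of common end vertices.\<close>

definition plane_drawing ::
  "('a, 'b) pre_digraph \<Rightarrow> ('a \<Rightarrow> real ^ 2) \<Rightarrow> ('a set \<Rightarrow> real \<Rightarrow> real ^ 2) \<Rightarrow> bool" where
  "plane_drawing G pos \<gamma> \<longleftrightarrow>
     inj_on pos (verts G) \<and>
     (\<forall>e \<in> uedges G. Path_Connected.arc (\<gamma> e) \<and>
        {pathstart (\<gamma> e), pathfinish (\<gamma> e)} = pos ` e \<and>
        path_image (\<gamma> e) \<inter> pos ` verts G = pos ` e) \<and>
     (\<forall>e \<in> uedges G. \<forall>f \<in> uedges G. e \<noteq> f \<longrightarrow>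
        path_image (\<gamma> e) \<inter> path_image (\<gamma> f) \<subseteq> pos ` (e \<inter> f))"

definition planar :: "('a, 'b) pre_digraph \<Rightarrow> bool" where
  "planar G \<longleftrightarrow> (\<exists>pos \<gamma>. plane_drawing G pos \<gamma>)"

end

theory Submission
  imports Defs
begin

text \<open>
  Fix a depth-first search tree. Every edge outside it joins a vertex \<open>v\<close>
  to an ancestor, necessarily the one \<open>r - 1\<close> levels higher because its fundamental cycle has
  length \<open>r\<close>; so there is at most one such edge per \<open>v\<close>, and \<open>card E \<le> n - 1 + k\<close>, where \<open>k\<close>
  counts these \<open>v\<close>. If the fundamental paths of \<open>v\<close> and \<open>w\<close>, with \<open>w\<close> at least as deep, share a
  tree edge, then the symmetric difference of the two cycles is again a cycle. It has length
  \<open>2 d + 2\<close>, where \<open>d\<close> is the distance from \<open>w\<close> to the lowest common ancestor, so \<open>r\<close> is even and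
  \<open>d = r / 2 - 1\<close>. Hence for odd \<open>r\<close> the paths are disjoint and \<open>k (r - 1) \<le> n - 1\<close>. For even \<open>r\<close>
  the lowest \<open>r / 2 - 1\<close> edges of each path are disjoint from the paths of all vertices that are
  not deeper; counting the whole path of a vertex of least depth and these lower parts of the
  others gives \<open>k (r / 2 - 1) + r / 2 \<le> n - 1\<close>.
\<close>

section \<open>Depth-first search trees: gluing and existence\<close>

text \<open>\<open>pth v\<close> lists the tree path from \<open>v\<close> up to the root \<open>x\<close>, and \<open>comparable\<close> is the
  characteristic property of depth-first search trees: there are no cross edges.\<close>

locale normal_tree =
  fixes adj :: "'a \<Rightarrow> 'a \<Rightarrow> bool" and S :: "'a set" and x :: 'a and pth :: "'a \<Rightarrow> 'a list"
  assumes sym: "adj u v \<Longrightarrow> adj v u"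
    and root: "x \<in> S"
    and pth_ne: "v \<in> S \<Longrightarrow> pth v \<noteq> []"
    and hd_pth: "v \<in> S \<Longrightarrow> hd (pth v) = v"
    and last_pth: "v \<in> S \<Longrightarrow> last (pth v) = x"
    and distinct_pth: "v \<in> S \<Longrightarrow> distinct (pth v)"
    and set_pth: "v \<in> S \<Longrightarrow> set (pth v) \<subseteq> S"
    and succ_pth: "v \<in> S \<Longrightarrow> successively adj (pth v)"
    and suffix_pth: "v \<in> S \<Longrightarrow> pth v = us @ y # ws \<Longrightarrow> pth y = y # ws"
    and comparable: "u \<in> S \<Longrightarrow> v \<in> S \<Longrightarrow> adj u v \<Longrightarrow> u \<in> set (pth v) \<or> v \<in> set (pth u)"
begin

lemma pth_root: "pth x = [x]"
proof -
  obtain zs where z: "pth x = x # zs"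
    using pth_ne[OF root] hd_pth[OF root] by (cases "pth x") auto
  then have "zs = []"
    using last_pth[OF root] distinct_pth[OF root] by (auto split: if_splits)
  with z show ?thesis by simp
qed

end

lemma normal_tree_singleton:
  assumes "\<And>u v. adj u v \<Longrightarrow> adj v u"
  shows "normal_tree adj {x} x (\<lambda>v. [v])"
  by unfold_locales (erule assms, simp_all add: Cons_eq_append_conv)

text \<open>The step of depth-first search: \<open>C\<close> is hung below \<open>x\<close> by the
  edge from \<open>y\<close>. By \<open>sep\<close> an edge between \<open>C\<close> and
  \<open>D\<close> meets \<open>D\<close> only in \<open>x\<close>, which all new paths from
  \<open>C\<close> contain, so no cross edge arises.\<close>

lemma normal_tree_join:
  assumes "normal_tree adj C y p" and "normal_tree adj D x q"
    and disj: "C \<inter> D = {}" and "adj y x"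
    and sep: "\<And>u v. u \<in> C \<Longrightarrow> v \<in> D \<Longrightarrow> adj u v \<Longrightarrow> v = x"
  shows "normal_tree adj (C \<union> D) x (\<lambda>v. if v \<in> C then p v @ [x] else q v)"
    (is "normal_tree adj _ x ?h")
proof -
  interpret C: normal_tree adj C y p by fact
  interpret D: normal_tree adj D x q by fact
  have xC: "x \<notin> C"
    using disj D.root by auto
  show ?thesis
  proof
    fix v us z ws
    assume v: "v \<in> C \<union> D" and eq: "?h v = us @ z # ws"
    show "?h z = z # ws"
    proof (cases "v \<in> C")
      case vC: True
      show ?thesis
      proof (cases ws rule: rev_cases)
        case Nil
        then show ?thesis using eq vC xC D.pth_root by simp
      next
        case (snoc ws' a)
        then have e: "p v = us @ z # ws'" "a = x"
          using eq vC by (simp_all flip: append_assoc append_Cons)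
        then have "z \<in> C"
          using C.set_pth[OF vC] by auto
        then show ?thesis
          using C.suffix_pth[OF vC e(1)] snoc e(2) by simp
      qed
    next
      case False
      then have "v \<in> D" "q v = us @ z # ws"
        using v eq by auto
      moreover from this have "z \<notin> C"
        using D.set_pth disj by fastforce
      ultimately show ?thesis
        using D.suffix_pth by simp
    qed
  next
    fix u v assume uv: "u \<in> C \<union> D" "v \<in> C \<union> D" "adj u v"
    have "v \<in> C \<Longrightarrow> u \<in> D \<Longrightarrow> u = x"
      using sep C.sym uv(3) by blast
    then show "u \<in> set (?h v) \<or> v \<in> set (?h u)"
      using uv C.comparable[of u v] D.comparable[of u v] sep[of u v] disj by auto
  next
    fix v assume v: "v \<in> C \<union> D"
    show "successively adj (?h v)"
      using v C.succ_pth[of v] D.succ_pth[of v] C.last_pth[of v] C.pth_ne[of v] \<open>adj y x\<close>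
      by (auto simp: successively_append_iff)
    show "distinct (?h v)"
      using v C.distinct_pth[of v] D.distinct_pth[of v] C.set_pth[of v] xC by auto
    show "set (?h v) \<subseteq> C \<union> D"
      using v C.set_pth[of v] D.set_pth[of v] D.root by auto
    show "?h v \<noteq> []" "hd (?h v) = v" "last (?h v) = x"
      using v C.pth_ne[of v] D.pth_ne[of v] C.hd_pth[of v] D.hd_pth[of v] D.last_pth[of v] by auto
  next
    show "adj v u" if "adj u v" for u v using that by (rule C.sym)
    show "x \<in> C \<union> D" using D.root by simp
  qed
qed

text \<open>Induction on \<open>card S\<close>: split off what a neighbour \<open>y\<close> of
  \<open>x\<close> reaches while avoiding \<open>x\<close>, and recurse on it with root
  \<open>y\<close> and on the rest with root \<open>x\<close>. Requiring every step to land in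
  \<open>S\<close> expresses connectedness of the induced subgraph.\<close>

lemma normal_tree_exists:
  assumes "finite S" "x \<in> S" and sym: "\<And>u v. adj u v \<Longrightarrow> adj v u"
    and "\<And>v. v \<in> S \<Longrightarrow> (\<lambda>u v. adj u v \<and> v \<in> S)\<^sup>*\<^sup>* x v"
  shows "\<exists>pth. normal_tree adj S x pth"
  using assms(1,2,4)
proof (induction "card S" arbitrary: S x rule: less_induct)
  case less
  show ?case
  proof (cases "\<exists>y \<in> S - {x}. adj x y")
    case False
    have "v = x" if "v \<in> S" for v
      using less.prems(3)[OF that]
    proof induction
      case (step y z)
      then show ?case using False by blast
    qed simp
    with less.prems(2) have "S = {x}" by blast
    then have "normal_tree adj S x (\<lambda>v. [v])"
      using normal_tree_singleton[OF sym] by simp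
    then show ?thesis by blast
  next
    case True
    then obtain y where y: "y \<in> S" "y \<noteq> x" "adj x y" by auto
    define C where "C = {v. (\<lambda>u v. adj u v \<and> v \<in> S - {x})\<^sup>*\<^sup>* y v}"
    define D where "D = S - C"
    have C_step: "v \<in> C" if "u \<in> C" "adj u v" "v \<in> S" "v \<noteq> x" for u v
      using that unfolding C_def by (auto intro: rtranclp.rtrancl_into_rtrancl)
    have "v \<in> S - {x}" if "v \<in> C" for v
      using that unfolding C_def mem_Collect_eq by induction (use y in auto)
    then have CS: "C \<subseteq> S - {x}" by auto
    have yC: "y \<in> C" by (simp add: C_def)
    have xD: "x \<in> D" using less.prems(2) CS by (auto simp: D_def)
    have "\<exists>p. normal_tree adj C y p"
    proof (rule less.hyps)
      show "card C < card S"
        using CS less.prems(1,2) by (intro psubset_card_mono) auto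
      show "finite C" using CS less.prems(1) finite_subset by blast
      fix v assume "v \<in> C"
      then have "(\<lambda>u v. adj u v \<and> v \<in> S - {x})\<^sup>*\<^sup>* y v" by (simp add: C_def)
      then have "(\<lambda>u v. adj u v \<and> v \<in> C)\<^sup>*\<^sup>* y v \<and> v \<in> C"
      proof induction
        case (step u w)
        then have "w \<in> C" using C_step by blast
        with step show ?case by (auto intro: rtranclp.rtrancl_into_rtrancl)
      qed (use yC in auto)
      then show "(\<lambda>u v. adj u v \<and> v \<in> C)\<^sup>*\<^sup>* y v" ..
    qed (rule yC)
    then obtain p where p: "normal_tree adj C y p" ..
    have "\<exists>q. normal_tree adj D x q"
    proof (rule less.hyps)
      show "card D < card S"
        using y yC less.prems(1) by (intro psubset_card_mono) (auto simp: D_def)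
      show "finite D" using less.prems(1) by (simp add: D_def)
      fix v assume "v \<in> D"
      then have "(\<lambda>u v. adj u v \<and> v \<in> S)\<^sup>*\<^sup>* x v"
        by (intro less.prems(3)) (simp add: D_def)
      \<comment> \<open>A walk can leave \<open>C\<close> only through \<open>x\<close>, where
        reachability inside \<open>D\<close> starts afresh.\<close>
      then have "v \<in> C \<or> (\<lambda>u v. adj u v \<and> v \<in> D)\<^sup>*\<^sup>* x v"
      proof induction
        case (step u w)
        show ?case
        proof (cases "w \<in> C \<or> w = x")
          case False
          then have "u \<notin> C" "w \<in> D"
            using step.hyps C_step by (auto simp: D_def)
          with step show ?thesis by (auto intro: rtranclp.rtrancl_into_rtrancl)
        qed auto
      qed auto
      then show "(\<lambda>u v. adj u v \<and> v \<in> D)\<^sup>*\<^sup>* x v"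
        using \<open>v \<in> D\<close> by (simp add: D_def)
    qed (rule xD)
    then obtain q where q: "normal_tree adj D x q" ..
    have "normal_tree adj (C \<union> D) x (\<lambda>v. if v \<in> C then p v @ [x] else q v)"
      by (rule normal_tree_join[OF p q]) (use C_step sym y in \<open>auto simp: D_def\<close>)
    moreover have "C \<union> D = S" using CS by (auto simp: D_def)
    ultimately show ?thesis by auto
  qed
qed

section \<open>Back edges when all cycles have the same length\<close>

text \<open>The start vertex is not repeated at the end, so \<open>length xs\<close> is also the
  number of edges.\<close>

definition vcycle :: "('a \<Rightarrow> 'a \<Rightarrow> bool) \<Rightarrow> 'a list \<Rightarrow> bool" where
  "vcycle adj xs \<longleftrightarrow>
     3 \<le> length xs \<and> distinct xs \<and> successively adj xs \<and> adj (last xs) (hd xs)"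

locale uniform_normal_tree = normal_tree adj S x pth
  for adj :: "'a \<Rightarrow> 'a \<Rightarrow> bool" and S x pth +
  fixes r :: nat
  assumes fin: "finite S" and r3: "3 \<le> r"
    and irrefl: "\<not> adj v v"
    and vcycle_length: "set xs \<subseteq> S \<Longrightarrow> vcycle adj xs \<Longrightarrow> length xs = r"
begin

text \<open>The lower end points of the edges outside the tree, see \<open>back_edge_index\<close>.\<close>

definition K :: "'a set" where
  "K = {v \<in> S. r \<le> length (pth v) \<and> adj v (pth v ! (r - 1))}"

text \<open>The edge closes the first \<open>j + 1\<close> vertices of the path to a cycle, so
  \<open>j + 1 = r\<close>; \<open>2 \<le> j\<close> provides the three vertices that a cycle
  needs.\<close>

lemma back_edge_index:
  assumes v: "v \<in> S" and "j < length (pth v)" "2 \<le> j" "adj v (pth v ! j)"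
  shows "j = r - 1"
proof -
  let ?xs = "take (j + 1) (pth v)"
  have "successively adj (?xs @ drop (j + 1) (pth v))"
    using succ_pth[OF v] by simp
  then have "successively adj ?xs"
    unfolding successively_append_iff by blast
  moreover have "last ?xs = pth v ! j"
    using assms by (simp add: take_Suc_conv_app_nth)
  moreover have "hd ?xs = v"
    using hd_pth[OF v] by simp
  moreover have "set ?xs \<subseteq> S"
    using set_pth[OF v] set_take_subset by fastforce
  ultimately have "length ?xs = r"
    using assms distinct_pth[OF v] sym by (intro vcycle_length) (auto simp: vcycle_def)
  then show ?thesis using assms by simp
qed

text \<open>By \<open>comparable\<close> one end of an edge lies on the path of the other: at index
  1 for a tree edge, at index \<open>r - 1\<close> otherwise.\<close>

lemma edges_subset:
  "{{u, v} | u v. u \<in> S \<and> v \<in> S \<and> adj u v} \<subseteq>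
     (\<lambda>v. {v, pth v ! 1}) ` (S - {x}) \<union> (\<lambda>v. {v, pth v ! (r - 1)}) ` K"
proof -
  have main: "{v, u} \<in> (\<lambda>v. {v, pth v ! 1}) ` (S - {x}) \<union> (\<lambda>v. {v, pth v ! (r - 1)}) ` K"
    if uv: "v \<in> S" "u \<in> set (pth v)" "adj v u" for u v
  proof -
    obtain j where j: "j < length (pth v)" "u = pth v ! j"
      using uv(2) by (auto simp: in_set_conv_nth)
    have "j \<noteq> 0"
      using j uv irrefl hd_pth[OF uv(1)] pth_ne[OF uv(1)] by (metis hd_conv_nth)
    then consider "j = 1" | "2 \<le> j" by linarith
    then show ?thesis
    proof cases
      case 1
      then have "v \<noteq> x" using j pth_root by auto
      then show ?thesis using 1 j uv by auto
    next
      case 2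
      then have "j = r - 1" using back_edge_index j uv by blast
      then have "v \<in> K" using j uv r3 by (auto simp: K_def)
      then show ?thesis using \<open>j = r - 1\<close> j by auto
    qed
  qed
  show ?thesis
  proof clarify
    fix u v assume "u \<in> S" "v \<in> S" "adj u v"
      and "{u, v} \<notin> (\<lambda>v. {v, pth v ! (r - 1)}) ` K"
    then show "{u, v} \<in> (\<lambda>v. {v, pth v ! 1}) ` (S - {x})"
      using comparable[of u v] main[of v u] main[of u v] sym[of u v]
      by (auto simp: insert_commute)
  qed
qed

lemma finite_K: "finite K"
  using fin by (simp add: K_def)

lemma card_edges_le:
  "card {{u, v} | u v. u \<in> S \<and> v \<in> S \<and> adj u v} \<le> card S - 1 + card K"
proof -
  have "card {{u, v} | u v. u \<in> S \<and> v \<in> S \<and> adj u v} \<le>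
      card ((\<lambda>v. {v, pth v ! 1}) ` (S - {x}) \<union> (\<lambda>v. {v, pth v ! (r - 1)}) ` K)"
    using fin finite_K by (intro card_mono edges_subset) auto
  also have "\<dots> \<le> card ((\<lambda>v. {v, pth v ! 1}) ` (S - {x})) +
      card ((\<lambda>v. {v, pth v ! (r - 1)}) ` K)"
    by (rule card_Un_le)
  also have "\<dots> \<le> card (S - {x}) + card K"
    using fin finite_K by (intro add_mono card_image_le) auto
  finally show ?thesis using root fin by simp
qed

text \<open>\<open>c\<close> is the lowest common ancestor, found as the first vertex of
  \<open>pth w\<close> on \<open>pth v\<close>. From there on both paths are
  \<open>pth c\<close>.\<close>

lemma common_suffix:
  assumes "v \<in> S" "w \<in> S"
  obtains as bs c cs where "pth v = as @ c # cs" "pth w = bs @ c # cs"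
    "set bs \<inter> set (pth v) = {}"
proof -
  have "\<exists>z \<in> set (pth w). z \<in> set (pth v)"
    using assms last_pth pth_ne by (metis last_in_set)
  then obtain bs c cs where w: "pth w = bs @ c # cs" and c: "c \<in> set (pth v)"
    and bs: "\<forall>z \<in> set bs. z \<notin> set (pth v)"
    using split_list_first_prop[of "pth w" "\<lambda>z. z \<in> set (pth v)"] by blast
  obtain as cs' where v: "pth v = as @ c # cs'"
    using c by (meson split_list)
  have "cs' = cs"
    using suffix_pth[OF assms(1) v] suffix_pth[OF assms(2) w] by simp
  with v w bs that show thesis by blast
qed

section \<open>Overlapping fundamental paths\<close>

text \<open>A tree edge is identified with its lower end point, so \<open>P v\<close> is the edge set of the
  fundamental path of \<open>v \<in> K\<close>.\<close>

definition P :: "'a \<Rightarrow> 'a set" where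
  "P v = set (take (r - 1) (pth v))"

text \<open>With \<open>c\<close> the lowest common ancestor, the combined cycle has length
  \<open>2 * length bs + 2\<close>. Hence \<open>length bs = r div 2 - 1\<close>, and
  \<open>bs\<close> is disjoint from \<open>pth v\<close> by the choice of \<open>c\<close>.\<close>

lemma overlap:
  assumes v: "v \<in> K" and w: "w \<in> K" and "v \<noteq> w"
    and le: "length (pth v) \<le> length (pth w)" and ov: "P v \<inter> P w \<noteq> {}"
  shows "even r" and "set (take (r div 2 - 1) (pth w)) \<inter> set (pth v) = {}"
proof -
  have vS: "v \<in> S" and wS: "w \<in> S" using v w by (auto simp: K_def)
  obtain as bs c cs where pv: "pth v = as @ c # cs" and pw: "pth w = bs @ c # cs"
    and bs: "set bs \<inter> set (pth v) = {}"
    using common_suffix[OF vS wS] .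
  have lab: "length as \<le> length bs" using le pv pw by simp
  have "bs \<noteq> []"
  proof
    assume "bs = []"
    then have "as = []" using lab by simp
    then show False
      using \<open>bs = []\<close> pv pw hd_pth[OF vS] hd_pth[OF wS] \<open>v \<noteq> w\<close> by simp
  qed
  \<comment> \<open>Otherwise \<open>P w\<close> would lie in \<open>bs\<close> and miss
    \<open>P v\<close>. So the back edge of \<open>w\<close> ends strictly above
    \<open>c\<close>.\<close>
  have lb: "length bs \<le> r - 2"
  proof (rule ccontr)
    assume "\<not> ?thesis"
    then have "take (r - 1) (pth w) = take (r - 1) bs" using pw by simp
    then have "P w \<subseteq> set bs" by (auto simp: P_def dest: in_set_takeD)
    moreover have "P v \<subseteq> set (pth v)" by (auto simp: P_def dest: in_set_takeD)
    ultimately show False using bs ov by blast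
  qed
  \<comment> \<open>The upper ends of the back edges of \<open>w\<close> and \<open>v\<close> have
    index \<open>r - 1\<close> in their paths; dropping the vertices up to and including
    \<open>c\<close> leaves the indices \<open>i\<close> and \<open>j\<close> in
    \<open>cs\<close>.\<close>
  define i j where "i = r - 2 - length bs" and "j = r - 2 - length as"
  have ij: "i \<le> j" using lab by (simp add: i_def j_def)
  have jl: "j < length cs"
    using v pv r3 lab lb by (auto simp: K_def j_def)
  have "r - 1 = length (bs @ [c]) + i" "r - 1 = length (as @ [c]) + j"
    using lb lab r3 by (simp_all add: i_def j_def)
  moreover have "pth w = (bs @ [c]) @ cs" "pth v = (as @ [c]) @ cs"
    using pw pv by simp_all
  ultimately have "pth w ! (r - 1) = cs ! i" "pth v ! (r - 1) = cs ! j"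
    by (metis nth_append_length_plus)+
  then have aw: "adj w (cs ! i)" and av: "adj v (cs ! j)"
    using v w by (auto simp: K_def)
  \<comment> \<open>The cycle runs from \<open>w\<close> up to \<open>c\<close>, down to \<open>v\<close>, along the back edge to \<open>cs ! j\<close>, down
    the tree to \<open>cs ! i\<close>, and along the back edge to \<open>w\<close>.\<close>
  define seg where "seg = drop i (take (Suc j) cs)"
  have seg: "length seg = Suc j - i" "seg \<noteq> []" "hd seg = cs ! i" "last seg = cs ! j"
    "set seg \<subseteq> set cs"
    using ij jl
    by (auto simp: seg_def hd_drop_conv_nth last_conv_nth dest!: in_set_dropD in_set_takeD)
  have "cs = take i (take (Suc j) cs) @ seg @ drop (Suc j) cs"
    unfolding seg_def by (metis append.assoc append_take_drop_id)
  then have "successively adj seg" "distinct seg"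
    using succ_pth[OF vS] distinct_pth[OF vS] unfolding pv
    by (metis append_Cons append_Nil successively_append_iff distinct_append)+
  have sR: "successively adj (rev ys)" if "successively adj ys" for ys
    using that sym by (auto simp: successively_rev intro: successively_mono)
  let ?xs = "bs @ rev (as @ [c]) @ rev seg"
  have "hd (as @ [c]) = v" using pv hd_pth[OF vS] by (cases as) auto
  have "hd bs = w" using pw hd_pth[OF wS] \<open>bs \<noteq> []\<close> by simp
  have "successively adj (as @ [c])" "successively adj bs" "adj (last bs) c"
    using succ_pth[OF vS] succ_pth[OF wS] pv pw \<open>bs \<noteq> []\<close>
    by (auto simp: successively_append_iff)
  then have "successively adj ?xs"
    using sR[of "as @ [c]"] sR[OF \<open>successively adj seg\<close>] \<open>bs \<noteq> []\<close> seg av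
      \<open>hd (as @ [c]) = v\<close>
    unfolding successively_append_iff by (auto simp: hd_rev last_rev)
  moreover have "distinct ?xs"
    using distinct_pth[OF vS] distinct_pth[OF wS] \<open>distinct seg\<close> seg(5) bs
    unfolding pv pw by auto
  moreover have "adj (last ?xs) (hd ?xs)"
    using seg \<open>bs \<noteq> []\<close> \<open>hd bs = w\<close> aw sym by (simp add: last_rev)
  \<comment> \<open>\<open>seg\<close> has \<open>length bs - length as + 1\<close> vertices, so
    \<open>length as\<close> cancels.\<close>
  moreover have len: "length ?xs = 2 * length bs + 2"
    using seg(1) ij lab lb by (simp add: i_def j_def)
  moreover have "1 \<le> length bs" using \<open>bs \<noteq> []\<close> by (cases bs) auto
  ultimately have "vcycle adj ?xs"
    unfolding vcycle_def by linarith
  moreover have "set ?xs \<subseteq> S"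
    using set_pth[OF vS] set_pth[OF wS] seg(5) unfolding pv pw by auto
  ultimately have "2 * length bs + 2 = r" using vcycle_length len by metis
  then show "even r" "set (take (r div 2 - 1) (pth w)) \<inter> set (pth v) = {}"
    using bs pw by auto
qed

section \<open>Counting disjoint sets of tree edges\<close>

text \<open>\<open>pth v\<close> has at least \<open>r\<close> vertices, so its first
  \<open>r - 1\<close> stop short of the root. This gives the bound \<open>card S - 1\<close> in the
  counts below.\<close>

lemma P_subset: "v \<in> K \<Longrightarrow> P v \<subseteq> S - {x}"
proof -
  assume "v \<in> K"
  then have v: "v \<in> S" "r \<le> length (pth v)" by (auto simp: K_def)
  then have "pth v = butlast (pth v) @ [x]"
    using last_pth pth_ne by (metis append_butlast_last_id)
  moreover have "P v \<subseteq> set (butlast (pth v))"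
    using v(2) set_take_subset_set_take[of "r - 1" "length (pth v) - 1" "pth v"]
    by (simp add: P_def butlast_conv_take)
  ultimately show ?thesis
    using distinct_pth[OF v(1)] set_pth[OF v(1)]
    by (metis (no_types, lifting) Diff_empty distinct_append in_set_butlastD
        not_distinct_conv_prefix subset_Diff_insert subset_iff)
qed

lemma card_take_pth: "v \<in> K \<Longrightarrow> i < r \<Longrightarrow> card (set (take i (pth v))) = i"
  using distinct_pth by (auto simp: K_def distinct_card)

lemma odd_bound:
  assumes "odd r"
  shows "card K * (r - 1) \<le> card S - 1"
proof -
  have "P v \<inter> P w = {}" if "v \<in> K" "w \<in> K" "v \<noteq> w" for v w
    using overlap(1)[of v w] overlap(1)[of w v] that assms
    by (metis Int_commute nle_le)
  then have "card (\<Union>v \<in> K. P v) = (\<Sum>v \<in> K. card (P v))"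
    using finite_K by (intro card_UN_disjoint) (auto simp: P_def)
  also have "\<dots> = card K * (r - 1)"
    using card_take_pth r3 by (simp add: P_def)
  finally have "card K * (r - 1) = card (\<Union>v \<in> K. P v)" ..
  also have "\<dots> \<le> card (S - {x})"
    using fin P_subset by (intro card_mono) auto
  finally show ?thesis using root fin by simp
qed

lemma even_bound:
  assumes "even r" "K \<noteq> {}"
  shows "card K * (r div 2 - 1) + r div 2 \<le> card S - 1"
proof -
  define B where "B w = set (take (r div 2 - 1) (pth w))" for w
  have BP: "B w \<subseteq> P w" for w
    unfolding B_def P_def by (intro set_take_subset_set_take) auto
  have PS: "P w \<subseteq> set (pth w)" for w
    by (simp add: P_def set_take_subset)
  \<comment> \<open>Only the path of the vertex that is at least as deep has to be cut to its lower
    part.\<close>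
  have disj: "B w \<inter> P v = {}"
    if "v \<in> K" "w \<in> K" "v \<noteq> w" "length (pth v) \<le> length (pth w)" for v w
    using overlap(2)[OF that] BP[of w] PS[of v] unfolding B_def by blast
  obtain v0 where v0: "v0 \<in> K" "\<And>w. w \<in> K \<Longrightarrow> length (pth v0) \<le> length (pth w)"
    using assms(2) ex_has_least_nat[of "\<lambda>w. w \<in> K" _ "\<lambda>w. length (pth w)"] by blast
  let ?U = "\<Union>w \<in> K - {v0}. B w"
  have "B v \<inter> B w = {}" if "v \<in> K" "w \<in> K" "v \<noteq> w" for v w
  proof (cases "length (pth v) \<le> length (pth w)")
    case True
    then show ?thesis using disj[of v w] that BP[of v] by blast
  next
    case False
    then show ?thesis using disj[of w v] that BP[of w] by fastforce
  qed
  then have "card ?U = (\<Sum>w \<in> K - {v0}. card (B w))"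
    using finite_K by (intro card_UN_disjoint) (auto simp: B_def)
  also have "\<dots> = (\<Sum>w \<in> K - {v0}. r div 2 - 1)"
    unfolding B_def using r3 by (intro sum.cong refl card_take_pth) auto
  also have "\<dots> = (card K - 1) * (r div 2 - 1)"
    using v0 finite_K by simp
  finally have cU: "card ?U = (card K - 1) * (r div 2 - 1)" .
  \<comment> \<open>As \<open>v0\<close> has least depth, its whole path can be counted along with
    the lower parts of the others.\<close>
  have "P v0 \<inter> ?U = {}"
    using disj[OF v0(1)] v0(2) by blast
  then have "card (P v0) + card ?U = card (P v0 \<union> ?U)"
    using finite_K by (intro card_Un_disjoint[symmetric]) (auto simp: P_def B_def)
  also have "card (P v0 \<union> ?U) \<le> card (S - {x})"
    using fin P_subset v0(1) BP by (intro card_mono) fastforce+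
  finally have "card (P v0) + card ?U \<le> card S - 1"
    using root fin by simp
  moreover have "card (P v0) = r - 1"
    unfolding P_def using v0 r3 by (intro card_take_pth) auto
  ultimately have le: "r - 1 + (card K - 1) * (r div 2 - 1) \<le> card S - 1"
    using cU by simp
  obtain s where "r = 2 * s" using assms(1) by (elim evenE)
  with r3 have s: "r = 2 * s" "2 \<le> s" by auto
  obtain k where k: "card K = Suc k"
    using v0(1) finite_K by (metis card_gt_0_iff gr0_conv_Suc empty_iff)
  \<comment> \<open>With \<open>r = 2 * s\<close> the whole path of \<open>v0\<close> contributes
    \<open>r - 1 = (s - 1) + s\<close>; the surplus \<open>s\<close> over a lower part is the
    summand \<open>r div 2\<close>.\<close>
  have "card K * (r div 2 - 1) + r div 2 = r - 1 + (card K - 1) * (r div 2 - 1)"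
    using s k by simp
  with le show ?thesis by simp
qed

end

section \<open>Cycles as vertex lists and as arc walks\<close>

lemma (in wf_digraph) awalk_of_vertices:
  assumes "successively (\<lambda>u v. u \<rightarrow>\<^bsub>G\<^esub> v) xs" "xs \<noteq> []" "set xs \<subseteq> verts G"
  shows "\<exists>p. awalk (hd xs) p (last xs) \<and> awalk_verts (hd xs) p = xs"
  using assms
proof (induction xs rule: induct_list012)
  case (2 u)
  then have "awalk u [] u \<and> awalk_verts u [] = [u]" by (simp add: awalk_Nil_iff)
  then show ?case by auto
next
  case (3 u v xs)
  then obtain p where p: "awalk v p (last (v # xs))" "awalk_verts v p = v # xs"
    by auto
  obtain e where "e \<in> arcs G" "tail G e = u" "head G e = v"
    using "3.prems" by auto
  then have "awalk u (e # p) (last (v # xs)) \<and> awalk_verts u (e # p) = u # v # xs"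
    using p by (simp add: awalk_Cons_iff)
  then show ?case by auto
qed simp

lemma (in wf_digraph) vcycle_imp_ucycle:
  assumes "vcycle (\<lambda>u v. u \<rightarrow>\<^bsub>G\<^esub> v) xs" "set xs \<subseteq> verts G"
  shows "\<exists>p. ucycle G p \<and> length p = length xs"
proof -
  \<comment> \<open>Starting at \<open>last xs\<close> makes the closing edge the first step, so the
    tail of the vertex list, which \<open>cycle\<close> requires to be distinct, is
    \<open>xs\<close> itself.\<close>
  let ?ys = "last xs # xs"
  have xs: "xs \<noteq> []" using assms by (auto simp: vcycle_def)
  have "successively (\<lambda>u v. u \<rightarrow>\<^bsub>G\<^esub> v) ?ys" "set ?ys \<subseteq> verts G"
    using assms xs by (auto simp: vcycle_def successively_Cons)
  then obtain p where p: "awalk (last xs) p (last xs)" "awalk_verts (last xs) p = ?ys"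
    using awalk_of_vertices[of ?ys] xs by auto
  have len: "length p = length xs"
    using length_awalk_verts[of "last xs" p] p(2) by simp
  then have "cycle p"
    unfolding cycle_def using p assms xs by (intro exI[of _ "last xs"]) (auto simp: vcycle_def)
  then show ?thesis using len assms by (auto simp: ucycle_def vcycle_def)
qed

text \<open>The tail of the vertex list of a cycle is distinct and has one entry per arc. This
  yields \<open>r \<le> n\<close>.\<close>

lemma (in fin_digraph) ucycle_length_le: "ucycle G p \<Longrightarrow> length p \<le> card (verts G)"
proof -
  assume "ucycle G p"
  then obtain u where u: "awalk u p u" "distinct (tl (awalk_verts u p))"
    by (auto simp: ucycle_def cycle_def)
  have "length p = card (set (tl (awalk_verts u p)))"
    using distinct_card[OF u(2)] length_awalk_verts[of u p] by simp
  also have "\<dots> \<le> card (verts G)"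
    using u(1) by (intro card_mono) (auto dest: list.set_sel(2)[OF awalk_verts_non_Nil])
  finally show ?thesis .
qed

theorem theorem4p9:
  fixes G :: "('a, 'b) pre_digraph" and n r :: nat
  assumes "Digraph.graph G"
    and "Digraph_Component.connected G"
    and "planar G"
    and "\<exists>p. ucycle G p"
    and "n = card (verts G)"
    and "r = girth G" and "girth G = circum G"
  shows "(even r \<and> n \<ge> 4 \<longrightarrow>
            int (card (uedges G)) \<le>
              int n - 1 + \<lfloor>(real n - real r / 2 - 1) / (real r / 2 - 1)\<rfloor>) \<and>
         (odd r \<and> n \<ge> 3 \<longrightarrow>
            int (card (uedges G)) \<le>
              int n - 1 + \<lfloor>(real n - 1) / (real r - 1)\<rfloor>)"
proof -
  interpret graph G by fact
  let ?adj = "\<lambda>u v. u \<rightarrow>\<^bsub>G\<^esub> v"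
  have finL: "finite (cycle_lengths G)"
    by (rule finite_cycle_lengths) unfold_locales
  \<comment> \<open>Every cycle length lies between girth and circumference, which coincide.\<close>
  have uniform: "length p = r" if "ucycle G p" for p
  proof -
    have "length p \<in> cycle_lengths G" using that by (simp add: cycle_lengths_def)
    then have "girth G \<le> length p" "length p \<le> circum G"
      using finL by (simp_all add: girth_def circum_def)
    then show ?thesis using assms(6,7) by simp
  qed
  obtain p where p: "ucycle G p" using assms(4) by blast
  have r3: "3 \<le> r" and rn: "r \<le> n"
    using p uniform[OF p] ucycle_length_le[OF p] assms(5) by (auto simp: ucycle_def)
  have sc: "strongly_connected G"
    using symmetric_connected_imp_strongly_connected[OF sym_arcs assms(2)] .
  then obtain x where x: "x \<in> verts G"
    by (auto simp: strongly_connected_def)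
  have "(\<lambda>u v. ?adj u v \<and> v \<in> verts G)\<^sup>*\<^sup>* x v" if "v \<in> verts G" for v
  proof -
    have "x \<rightarrow>\<^sup>*\<^bsub>G\<^esub> v" using sc x that by auto
    then show ?thesis
      by (induction rule: reachable_induct)
        (auto intro: rtranclp.rtrancl_into_rtrancl reachable_in_verts)
  qed
  then obtain pth where "normal_tree ?adj (verts G) x pth"
    using normal_tree_exists[of "verts G" x ?adj] x graph_symmetric by auto
  then interpret normal_tree ?adj "verts G" x pth .
  interpret uniform_normal_tree ?adj "verts G" x pth r
  proof
    fix xs assume "set xs \<subseteq> verts G" "vcycle ?adj xs"
    then obtain p where "ucycle G p" "length p = length xs"
      using vcycle_imp_ucycle by blast
    then show "length xs = r" using uniform by metis
  next
    show "\<not> ?adj v v" for v using adj_not_same by blast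
  qed (rule finite_verts r3)+
  have sub: "uedges G \<subseteq> {{u, v} | u v. u \<in> verts G \<and> v \<in> verts G \<and> ?adj u v}"
  proof
    fix a assume "a \<in> uedges G"
    then obtain e where "e \<in> arcs G" "a = {tail G e, head G e}"
      by (auto simp: uedges_def)
    then show "a \<in> {{u, v} | u v. u \<in> verts G \<and> v \<in> verts G \<and> ?adj u v}"
      using in_arcs_imp_in_arcs_ends wellformed by blast
  qed
  have "finite {{u, v} | u v. u \<in> verts G \<and> v \<in> verts G \<and> ?adj u v}"
    by (rule finite_subset[of _ "Pow (verts G)"]) auto
  then have E: "card (uedges G) \<le> n - 1 + card K"
    using card_mono[OF _ sub] card_edges_le assms(5) by simp
  have "int (card K) \<le> \<lfloor>(real n - real r / 2 - 1) / (real r / 2 - 1)\<rfloor>" if ev: "even r"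
  proof -
    obtain s where "r = 2 * s" using ev by (elim evenE)
    with r3 have s: "r = 2 * s" "2 \<le> s" by auto
    have "card K * (s - 1) + s \<le> n - 1"
    \<comment> \<open>Without back edges there is no vertex of least depth to count from; the claim
      is then \<open>s \<le> n - 1\<close>, which follows from
      \<open>2 * s = r \<le> n\<close>.\<close>
    proof (cases "K = {}")
      case False
      then show ?thesis using even_bound[OF ev] s assms(5) by simp
    qed (use s rn in simp)
    then have "real (card K * (s - 1) + s) \<le> real (n - 1)" by linarith
    \<comment> \<open>The natural subtractions are exact by \<open>2 \<le> s\<close> and
      \<open>r \<le> n\<close>; moving \<open>s\<close> to the right produces the numerator of the
      bound.\<close>
    then have "real (card K) * (real s - 1) \<le> real n - real s - 1"
      using s rn by simp
    then show ?thesis using s by (simp add: le_floor_iff pos_le_divide_eq)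
  qed
  moreover have "int (card K) \<le> \<lfloor>(real n - 1) / (real r - 1)\<rfloor>" if "odd r"
  proof -
    have "real (card K * (r - 1)) \<le> real (n - 1)"
      using odd_bound[OF that] assms(5) by (simp only: of_nat_le_iff)
    then show ?thesis
      using r3 rn by (simp add: le_floor_iff pos_le_divide_eq)
  qed
  moreover have "int (card (uedges G)) \<le> int n - 1 + int (card K)"
    using E r3 rn by linarith
  ultimately show ?thesis by (auto intro: order_trans)
qed

end
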